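(* Let $k\ge 2$, let $n_1,\dots,n_k\ge 1$ be integers, let $K_{n_1,\dots,n_k}$ be the complete multipartite graph with colour classes of orders $n_1,\dots,n_k$, and let $n=n_1+\dots+n_k=|V(K_{n_1,\dots,n_k})|$. Then $$-n(k-1)+\tfrac34k(k-1)-1+\tfrac12\Big(\sum_{1\le i<j\le k}n_in_j\Big)\ \le\ \mathrm{tw}(L(K_{n_1,\dots,n_k}))\ \le\ \mathrm{pw}(L(K_{n_1,\dots,n_k}))$$ and $$\mathrm{pw}(L(K_{n_1,\dots,n_k}))\ \le\ \tfrac12n(k+5)+\tfrac14k(k-1)-4+\tfrac12\Big(\sum_{1\le i<j\le k}n_in_j\Big),$$ where $L(\cdot)$ denotes the line graph, $\mathrm{tw}$ treewidth and $\mathrm{pw}$ pathwidth.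
   Context: All graphs are finite and simple. The complete multipartite graph $K_{n_1,\dots,n_k}$ has $k$ colour classes of orders $n_1,\dots,n_k$, with an edge between two vertices exactly when they lie in different colour classes. The line graph $L(G)$ of $G$ has vertex set $E(G)$, two vertices of $L(G)$ being adjacent when the corresponding (distinct) edges of $G$ share an endpoint. A tree decomposition of a graph $G$ is a pair $(T,\{A_x\subseteq V(G):x\in V(T)\})$ where $T$ is a tree, such that for every $v\in V(G)$ the nodes $x$ with $v\in A_x$ induce a non-empty connected subtree of $T$, and for every edge $vw\in E(G)$ some bag $A_x$ contains both $v$ and $w$. Its width is the maximum size of a bag minus $1$. The treewidth $\mathrm{tw}(G)$ is the minimum width of a tree decomposition of $G$; the pathwidth $\mathrm{pw}(G)$ is the minimum width of a tree decomposition of $G$ whose underlying tree is a path. *)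

theory Defs
  imports Complex_Main "Graph_Theory.Graph_Theory"
begin

text \<open>
  A finite simple graph is a \<^locale>\<open>pair_graph\<close>: a finite vertex set together with a
  symmetric irreflexive set of pairs of vertices, so that each edge is represented by its two
  orientations.
\<close>

definition complete_multipartite :: "nat \<Rightarrow> (nat \<Rightarrow> nat) \<Rightarrow> (nat \<times> nat) pair_pre_digraph" where
  "complete_multipartite k n =
     \<lparr> pverts = (SIGMA i:{1..k}. {1..n i}),
       parcs = {(u, v). u \<in> (SIGMA i:{1..k}. {1..n i}) \<and> v \<in> (SIGMA i:{1..k}. {1..n i})
                        \<and> fst u \<noteq> fst v} \<rparr>"

definition uedges :: "'a pair_pre_digraph \<Rightarrow> 'a set set" where
  "uedges G = {{u, v} | u v. (u, v) \<in> parcs G}"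

definition line_graph :: "'a pair_pre_digraph \<Rightarrow> 'a set pair_pre_digraph" where
  "line_graph G =
     \<lparr> pverts = uedges G,
       parcs = {(e, f). e \<in> uedges G \<and> f \<in> uedges G \<and> e \<noteq> f \<and> e \<inter> f \<noteq> {}} \<rparr>"

text \<open>
  In a symmetric digraph \<^const>\<open>pre_digraph.cycle\<close> also holds of the closed walks
  \<open>u, v, u\<close> of length 2 along a single edge, so \<^const>\<open>forest\<close> and \<^const>\<open>tree\<close> do not have their
  usual undirected meaning here. The cycles of a simple graph are those of length at least 3.
  Connectedness includes non-emptiness.
\<close>

definition utree :: "'a pair_pre_digraph \<Rightarrow> bool" where
  "utree T \<longleftrightarrow> pair_graph T \<and> connected (with_proj T) \<and>
     \<not> (\<exists>p. pre_digraph.cycle (with_proj T) p \<and> 3 \<le> length p)"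

definition path_graph :: "'a pair_pre_digraph \<Rightarrow> bool" where
  "path_graph T \<longleftrightarrow> (\<exists>xs. xs \<noteq> [] \<and> distinct xs \<and> pverts T = set xs \<and>
     parcs T = {(xs ! i, xs ! Suc i) | i. Suc i < length xs}
             \<union> {(xs ! Suc i, xs ! i) | i. Suc i < length xs})"

definition tree_decomposition ::
  "'a pair_pre_digraph \<Rightarrow> 't pair_pre_digraph \<Rightarrow> ('t \<Rightarrow> 'a set) \<Rightarrow> bool" where
  "tree_decomposition G T A \<longleftrightarrow>
     utree T \<and>
     (\<forall>x\<in>pverts T. A x \<subseteq> pverts G) \<and>
     (\<forall>v\<in>pverts G. connected (with_proj T \<restriction> {x \<in> pverts T. v \<in> A x})) \<and>
     (\<forall>(v, w)\<in>parcs G. \<exists>x\<in>pverts T. v \<in> A x \<and> w \<in> A x)"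

text \<open>The width is an integer, as it is \<open>-1\<close> when all bags are empty.\<close>

definition width :: "'t pair_pre_digraph \<Rightarrow> ('t \<Rightarrow> 'a set) \<Rightarrow> int" where
  "width T A = Max ((\<lambda>x. int (card (A x))) ` pverts T) - 1"

text \<open>
  Trees are finite, so it is no restriction to take their nodes from \<^typ>\<open>nat\<close>.
\<close>

definition treewidth :: "'a pair_pre_digraph \<Rightarrow> int" where
  "treewidth G = (LEAST w. \<exists>(T :: nat pair_pre_digraph) A. tree_decomposition G T A \<and> width T A = w)"

definition pathwidth :: "'a pair_pre_digraph \<Rightarrow> int" where
  "pathwidth G = (LEAST w. \<exists>(T :: nat pair_pre_digraph) A.
     tree_decomposition G T A \<and> path_graph T \<and> width T A = w)"

lemma pair_graph_complete_multipartite: "pair_graph (complete_multipartite k n)"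
proof -
  have "finite (parcs (complete_multipartite k n))"
    by (rule finite_subset[of _ "(SIGMA i:{1..k}. {1..n i}) \<times> (SIGMA i:{1..k}. {1..n i})"])
       (auto simp: complete_multipartite_def)
  then show ?thesis
    by unfold_locales
       (auto simp: complete_multipartite_def symmetric_def intro!: symI)
qed

lemma card_verts_complete_multipartite:
  "card (pverts (complete_multipartite k n)) = (\<Sum>i=1..k. n i)"
  by (simp add: complete_multipartite_def)

lemma pair_graph_line_graph:
  assumes "pair_graph G"
  shows "pair_graph (line_graph G)"
proof -
  interpret pair_graph G by fact
  have "uedges G = (\<lambda>(u, v). {u, v}) ` parcs G"
    by (auto simp: uedges_def)
  then have fin: "finite (uedges G)"
    using pair_finite_arcs by simp
  have "finite (parcs (line_graph G))"
    by (rule finite_subset[of _ "uedges G \<times> uedges G"]) (auto simp: line_graph_def fin)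
  then show ?thesis
    by unfold_locales (auto simp: line_graph_def symmetric_def fin intro!: symI)
qed

lemma utree_singleton: "utree \<lparr> pverts = {x}, parcs = {} \<rparr>"
proof -
  let ?T = "\<lparr> pverts = {x}, parcs = {} \<rparr>"
  have "pair_graph ?T"
    by unfold_locales (auto simp: symmetric_def sym_def)
  moreover have "connected (with_proj ?T)"
    by (auto simp: connected_def strongly_connected_def mk_symmetric_def reachable_def
             intro: rtrancl_on_refl)
  moreover have "\<not> pre_digraph.cycle (with_proj ?T) p" for p
    by (auto simp: pre_digraph.cycle_def pre_digraph.awalk_def)
  ultimately show ?thesis by (auto simp: utree_def)
qed

lemma tree_decomposition_singleton:
  assumes "pair_graph G"
  shows "tree_decomposition G \<lparr> pverts = {x}, parcs = {} \<rparr> (\<lambda>_. pverts G)"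
proof -
  interpret pair_graph G by fact
  have "connected (with_proj \<lparr> pverts = {x}, parcs = {} \<rparr> \<restriction> {x})"
    by (auto simp: connected_def strongly_connected_def mk_symmetric_def reachable_def
             intro: rtrancl_on_refl)
  then show ?thesis
    by (auto simp: tree_decomposition_def utree_singleton dest: wellformed')
qed

lemma width_ge: "utree T \<Longrightarrow> -1 \<le> width T A"
proof -
  assume T: "utree T"
  then interpret pair_graph T by (simp add: utree_def)
  from T obtain x where "x \<in> pverts T"
    by (auto simp: utree_def connected_def strongly_connected_def mk_symmetric_def)
  then have "int (card (A x)) \<le> Max ((\<lambda>x. int (card (A x))) ` pverts T)"
    by (intro Max_ge) (auto simp: pair_finite_verts)
  then show ?thesis by (simp add: width_def)
qed

lemma int_Least:
  fixes P :: "int \<Rightarrow> bool"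
  assumes "P a" and "\<And>w. P w \<Longrightarrow> b \<le> w"
  shows int_LeastI: "P (LEAST w. P w)" and int_Least_le: "(LEAST w. P w) \<le> a"
proof -
  define m where "m = (LEAST m. P (b + int m))"
  have ex: "P (b + int (nat (a - b)))"
    using assms by simp
  have m: "P (b + int m)"
    unfolding m_def using ex by (rule LeastI)
  have le: "b + int m \<le> w" if "P w" for w
  proof -
    have "m \<le> nat (w - b)"
      unfolding m_def using assms(2)[OF that] that by (intro Least_le) simp
    then show ?thesis using assms(2)[OF that] by linarith
  qed
  have "(LEAST w. P w) = b + int m"
    using m le by (rule Least_equality)
  then show "P (LEAST w. P w)" "(LEAST w. P w) \<le> a"
    using m le assms(1) by auto
qed

lemma treewidth_attained:
  assumes "pair_graph G"
  shows "\<exists>(T :: nat pair_pre_digraph) A. tree_decomposition G T A \<and> width T A = treewidth G"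
  unfolding treewidth_def
proof (rule int_LeastI)
  show "\<exists>(T :: nat pair_pre_digraph) A. tree_decomposition G T A \<and>
          width T A = width \<lparr> pverts = {0 :: nat}, parcs = {} \<rparr> (\<lambda>_. pverts G)"
    by (intro exI conjI) (rule tree_decomposition_singleton[OF assms], rule refl)
next
  fix w assume "\<exists>(T :: nat pair_pre_digraph) A. tree_decomposition G T A \<and> width T A = w"
  then show "-1 \<le> w" by (auto simp: tree_decomposition_def width_ge)
qed

lemma treewidth_le:
  fixes T :: "nat pair_pre_digraph"
  assumes "tree_decomposition G T A"
  shows "treewidth G \<le> width T A"
  unfolding treewidth_def
proof (rule int_Least_le)
  show "\<exists>(T' :: nat pair_pre_digraph) A'. tree_decomposition G T' A' \<and> width T' A' = width T A"
    by (intro exI conjI) (rule assms refl)+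
next
  fix w assume "\<exists>(T :: nat pair_pre_digraph) A. tree_decomposition G T A \<and> width T A = w"
  then show "-1 \<le> w" by (auto simp: tree_decomposition_def width_ge)
qed

lemma path_graph_singleton: "path_graph \<lparr> pverts = {x}, parcs = {} \<rparr>"
  unfolding path_graph_def by (rule exI[of _ "[x]"]) auto

lemma pathwidth_attained:
  assumes "pair_graph G"
  shows "\<exists>(T :: nat pair_pre_digraph) A.
           tree_decomposition G T A \<and> path_graph T \<and> width T A = pathwidth G"
  unfolding pathwidth_def
proof (rule int_LeastI)
  show "\<exists>(T :: nat pair_pre_digraph) A. tree_decomposition G T A \<and> path_graph T \<and>
          width T A = width \<lparr> pverts = {0 :: nat}, parcs = {} \<rparr> (\<lambda>_. pverts G)"
    by (intro exI conjI) (rule tree_decomposition_singleton[OF assms], rule path_graph_singleton, rule refl)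
next
  fix w assume "\<exists>(T :: nat pair_pre_digraph) A.
    tree_decomposition G T A \<and> path_graph T \<and> width T A = w"
  then show "-1 \<le> w" by (auto simp: tree_decomposition_def width_ge)
qed

lemma pathwidth_le:
  fixes T :: "nat pair_pre_digraph"
  assumes "tree_decomposition G T A" "path_graph T"
  shows "pathwidth G \<le> width T A"
  unfolding pathwidth_def
proof (rule int_Least_le)
  show "\<exists>(T' :: nat pair_pre_digraph) A'. tree_decomposition G T' A' \<and> path_graph T' \<and> width T' A' = width T A"
    by (intro exI conjI) (rule assms refl)+
next
  fix w assume "\<exists>(T :: nat pair_pre_digraph) A. tree_decomposition G T A \<and> path_graph T \<and> width T A = w"
  then show "-1 \<le> w" by (auto simp: tree_decomposition_def width_ge)
qed

end

theory Submission
  imports Defs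
begin

text \<open>
  Lower bound, in the stronger form that some bag contains half of the edges of
  \<open>G = K(n\<^sub>1, \<dots>, n\<^sub>k)\<close>. Fix a tree decomposition of \<open>L(G)\<close> and a node \<open>x\<close>. The edges at a vertex
  \<open>v\<close> pairwise share a bag, so those outside the bag of \<open>x\<close> all live in one component of \<open>T - x\<close>.
  Hence the vertices of \<open>G\<close> are partitioned, by component, in such a way that every edge between two
  parts lies in the bag of \<open>x\<close> (vertices with all their edges in that bag are singletons). Some \<open>x\<close>
  has no part with more than half of the vertices: otherwise, take a node \<open>x\<close> and a heavy component
  \<open>C\<close> of \<open>T - x\<close> with \<open>C\<close> smallest; for the neighbour \<open>y\<close> of \<open>x\<close> in \<open>C\<close>, the heavy component of
  \<open>T - y\<close> is strictly inside \<open>C\<close>. For a partition into parts of at most half of the vertices, at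
  most half of the edges of \<open>G\<close> lie inside parts.

  Upper bound. For an ordering of the vertices of \<open>G\<close>, the edges \<open>uv\<close> with \<open>u \<le> p \<le> v\<close> form the
  bags of a path decomposition of \<open>L(G)\<close>. Each colour class is spread evenly over the ordering, so
  that the number of its vertices in any prefix deviates by at most \<open>1/2\<close> from its fair share.
\<close>

section \<open>Connectedness and cycles\<close>

text \<open>The arcs of a \<open>pair_graph\<close> are already symmetric, so the symmetrisation
  inside \<open>connected\<close> adds nothing, and a walk in the restricted relation that starts in
  \<open>S\<close> stays in \<open>S\<close>. This replaces connectedness by plain
  \<open>rtrancl\<close>, on which the later inductions run.\<close>

lemma connected_induce_iff:
  assumes "pair_graph T" "S \<subseteq> pverts T"
  shows "connected (with_proj T \<restriction> S) \<longleftrightarrow>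
    S \<noteq> {} \<and> (\<forall>u\<in>S. \<forall>v\<in>S. (u, v) \<in> (Restr (parcs T) S)\<^sup>*)"
proof -
  interpret pair_graph T by fact
  have sym: "(v, u) \<in> parcs T" if "(u, v) \<in> parcs T" for u v
    using that pair_sym_arcs by (auto simp: symmetric_def sym_def)
  have arcs: "parcs (mk_symmetric (with_proj T \<restriction> S)) = Restr (parcs T) S"
    by (auto simp: mk_symmetric_def induce_subgraph_def dest: sym)
  have rtrancl: "(u, v) \<in> rtrancl_on S (Restr (parcs T) S) \<longleftrightarrow> (u, v) \<in> (Restr (parcs T) S)\<^sup>*"
    if "u \<in> S" "v \<in> S" for u v
  proof
    assume "(u, v) \<in> (Restr (parcs T) S)\<^sup>*"
    then show "(u, v) \<in> rtrancl_on S (Restr (parcs T) S)"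
      using that by (rule rtrancl_consistent_rtrancl_on) auto
  qed (rule rtrancl_on_rtranclI)
  show ?thesis
    by (simp add: connected_def strongly_connected_def reachable_def arcs rtrancl)
qed

lemma connected_iff:
  assumes "pair_graph T"
  shows "connected (with_proj T) \<longleftrightarrow>
    pverts T \<noteq> {} \<and> (\<forall>u\<in>pverts T. \<forall>v\<in>pverts T. (u, v) \<in> (Restr (parcs T) (pverts T))\<^sup>*)"
proof -
  interpret pair_graph T by fact
  have "with_proj T \<restriction> pverts T = with_proj T"
    by (auto simp: induce_subgraph_def with_proj_def dest: wellformed')
  then show ?thesis
    using connected_induce_iff[OF assms order.refl] by simp
qed

text \<open>With all elements of the type as vertices and \<open>R\<close> as arcs, any relation
  becomes a digraph, so the extraction of a vertex-simple path from reachability applies to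
  it.\<close>

lemma rtrancl_imp_distinct_walk:
  assumes "(u, v) \<in> R\<^sup>*"
  shows "\<exists>p. pcas u p v \<and> set p \<subseteq> R \<and> distinct (pawalk_verts u p)"
proof -
  define H :: "'a pair_pre_digraph" where "H = \<lparr> pverts = UNIV, parcs = R \<rparr>"
  interpret H: pair_wf_digraph H
    by unfold_locales (auto simp: H_def)
  have "u \<rightarrow>\<^sup>*\<^bsub>with_proj H\<^esub> v"
    using rtrancl_consistent_rtrancl_on[OF assms, of UNIV] by (simp add: reachable_def H_def)
  then obtain p where "H.apath u p v"
    using H.reachable_apath by blast
  then show ?thesis
    unfolding H.apath_def H.awalk_def by (auto simp: H_def)
qed

text \<open>Otherwise a simple walk from \<open>y\<close> to \<open>z\<close> that avoids
  \<open>x\<close>, closed up by the two arcs at \<open>x\<close>, would be a cycle.\<close>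

lemma utree_unique_neighbour:
  assumes T: "utree T" and xy: "(x, y) \<in> parcs T" and xz: "(x, z) \<in> parcs T"
    and yz: "(y, z) \<in> (Restr (parcs T) (- {x}))\<^sup>*"
  shows "y = z"
proof (rule ccontr)
  assume "y \<noteq> z"
  interpret pair_graph T using T by (simp add: utree_def)
  have zx: "(z, x) \<in> parcs T"
    using xz pair_sym_arcs by (auto simp: symmetric_def sym_def)
  obtain p where p: "pcas y p z" "set p \<subseteq> Restr (parcs T) (- {x})" "distinct (pawalk_verts y p)"
    using rtrancl_imp_distinct_walk[OF yz] by blast
  have "p \<noteq> []" using p(1) \<open>y \<noteq> z\<close> by auto
  have cas: "pcas y (p @ [(z, x)]) x" and verts: "pawalk_verts y (p @ [(z, x)]) = pawalk_verts y p @ [x]"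
    if "pcas y p z" for y using that by (induct p arbitrary: y) auto
  have "x \<notin> set (pawalk_verts y p)" if "y \<noteq> x" "set p \<subseteq> Restr (parcs T) (- {x})" for y
    using that by (induct p arbitrary: y) auto
  moreover have "y \<noteq> x" using pair_no_loops[OF xy] by auto
  ultimately have "pre_digraph.cycle (with_proj T) ((x, y) # p @ [(z, x)])"
    using xy zx p cas[OF p(1)] verts[OF p(1)] in_arcsD1[OF xy]
    by (auto simp: cycle_def awalk_def)
  \<comment> \<open>As \<open>y\<close> and \<open>z\<close> differ, \<open>p\<close> has at least
    one arc, so the cycle has at least three; a step back and forth along one edge would not
    contradict \<open>utree\<close>.\<close>
  moreover have "3 \<le> length ((x, y) # p @ [(z, x)])" using \<open>p \<noteq> []\<close> by (cases p) auto
  ultimately show False using T by (auto simp: utree_def)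
qed


section \<open>A balanced bag\<close>

text \<open>\<open>f\<close> encodes the partition of the vertices: \<open>Inl C\<close> names the
  component \<open>C\<close> of \<open>T - x\<close> that holds the edges at a vertex missing from
  the bag of \<open>x\<close>, and \<open>Inr v\<close> isolates a vertex \<open>v\<close> with no
  missing edge.\<close>

lemma balanced_bag:
  fixes T :: "'t pair_pre_digraph" and A :: "'t \<Rightarrow> 'a set set"
  assumes G: "pair_graph G" "2 \<le> card (pverts G)"
    and dec: "tree_decomposition (line_graph G) T A"
  obtains x and f :: "'a \<Rightarrow> 't set + 'a" where "x \<in> pverts T"
    and "\<And>u v. (u, v) \<in> parcs G \<Longrightarrow> {u, v} \<notin> A x \<Longrightarrow> f u = f v"
    and "\<And>c. 2 * card {v \<in> pverts G. f v = c} \<le> card (pverts G)"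
proof -
  interpret G: pair_graph G by fact
  have T: "utree T" using dec by (simp add: tree_decomposition_def)
  then interpret T: pair_graph T by (simp add: utree_def)
  define V where "V = pverts T"
  define R where "R = parcs T"
  have symR: "sym R" using T.pair_sym_arcs by (simp add: R_def symmetric_def)
  have finV: "finite V" using T.pair_finite_verts by (simp add: V_def)
  have "V \<noteq> {}" and connT: "\<And>u v. u \<in> V \<Longrightarrow> v \<in> V \<Longrightarrow> (u, v) \<in> (Restr R V)\<^sup>*"
    using T by (auto simp: utree_def connected_iff V_def R_def)
  define comp where "comp x z = {w. (z, w) \<in> (Restr R (V - {x}))\<^sup>*}" for x z
  have comp_refl: "z \<in> comp x z" for x z by (simp add: comp_def)
  have comp_step: "w' \<in> comp x z" if "w \<in> comp x z" "(w, w') \<in> R" "w \<in> V - {x}" "w' \<in> V - {x}" for w w' x z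
    using that by (auto simp: comp_def intro: rtrancl_into_rtrancl)
  have comp_sub: "comp x z \<subseteq> V - {x}" if "z \<in> V - {x}" for x z
  proof
    fix w assume "w \<in> comp x z"
    then have "(z, w) \<in> (Restr R (V - {x}))\<^sup>*" by (simp add: comp_def)
    then show "w \<in> V - {x}" using that by (induct rule: rtrancl_induct) auto
  qed
  have comp_eq: "comp x w = comp x z" if "w \<in> comp x z" for x w z
  proof -
    have "sym ((Restr R (V - {x}))\<^sup>*)"
      using symR by (intro sym_rtrancl) (auto simp: sym_def)
    then have "(w, z) \<in> (Restr R (V - {x}))\<^sup>*" "(z, w) \<in> (Restr R (V - {x}))\<^sup>*"
      using that by (auto simp: comp_def dest: symD)
    then show ?thesis by (auto simp: comp_def intro: rtrancl_trans)
  qed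
  have conn: "{z \<in> V. e \<in> A z} \<noteq> {} \<and> (\<forall>u\<in>{z \<in> V. e \<in> A z}. \<forall>v\<in>{z \<in> V. e \<in> A z}. (u, v) \<in> (Restr R {z \<in> V. e \<in> A z})\<^sup>*)"
    if "e \<in> uedges G" for e
  proof -
    have "connected (with_proj T \<restriction> {z \<in> V. e \<in> A z})"
      using dec that by (simp add: tree_decomposition_def line_graph_def V_def)
    then show ?thesis
      by (subst (asm) connected_induce_iff[OF T.pair_graph_axioms]) (auto simp: V_def R_def)
  qed
  \<comment> \<open>The subtree of \<open>e\<close> is connected and avoids \<open>x\<close>, so it
    stays within one component of \<open>T - x\<close>.\<close>
  have same: "w \<in> comp x z" if "e \<in> uedges G" "e \<notin> A x" "z \<in> V" "e \<in> A z" "w \<in> V" "e \<in> A w" for e x z w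
  proof -
    have "(z, w) \<in> (Restr R {z \<in> V. e \<in> A z})\<^sup>*" using conn[OF that(1)] that by blast
    moreover have "Restr R {z \<in> V. e \<in> A z} \<subseteq> Restr R (V - {x})" using that(2) by auto
    ultimately have "(z, w) \<in> (Restr R (V - {x}))\<^sup>*" by (meson rtrancl_mono subsetD)
    then show ?thesis by (simp add: comp_def)
  qed
  have share: "\<exists>t\<in>V. e \<in> A t \<and> e' \<in> A t"
    if "e \<in> uedges G" "e' \<in> uedges G" "v \<in> e" "v \<in> e'" for e e' v
  proof (cases "e = e'")
    case True
    then show ?thesis using conn[OF that(1)] by auto
  next
    case False
    then have "(e, e') \<in> parcs (line_graph G)" using that by (auto simp: line_graph_def)
    then show ?thesis using dec by (auto simp: tree_decomposition_def V_def)
  qed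
  \<comment> \<open>A bag shared by the two edges ties their subtrees together, so all edges at
    \<open>v\<close> missing from the bag of \<open>x\<close> live in the same component.\<close>
  have meet: "comp x z = comp x z'"
    if "e \<in> uedges G" "e' \<in> uedges G" "v \<in> e" "v \<in> e'" "e \<notin> A x" "e' \<notin> A x"
      "z \<in> V" "z' \<in> V" "e \<in> A z" "e' \<in> A z'" for e e' v x z z'
  proof -
    have "\<exists>t\<in>V. e \<in> A t \<and> e' \<in> A t" by (rule share[OF that(1-4)])
    then obtain t where "t \<in> V" "e \<in> A t" "e' \<in> A t" by blast
    then have "t \<in> comp x z" "t \<in> comp x z'" using same that by blast+
    then show ?thesis using comp_eq by metis
  qed
  define P where "P x C = {v \<in> pverts G. \<exists>e\<in>uedges G. v \<in> e \<and> e \<notin> A x \<and> (\<exists>z\<in>C. e \<in> A z)}" for x C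
  have finP: "finite (P x C)" for x C
    using G.pair_finite_verts by (simp add: P_def)
  have "\<exists>x\<in>V. \<forall>z\<in>V - {x}. 2 * card (P x (comp x z)) \<le> card (pverts G)"
  proof (rule ccontr)
    define heavy where "heavy x z \<longleftrightarrow> x \<in> V \<and> z \<in> V - {x} \<and> card (pverts G) < 2 * card (P x (comp x z))" for x z
    assume "\<not> ?thesis"
    then have ex: "\<exists>z. heavy x z" if "x \<in> V" for x
      using that by (auto simp: heavy_def not_le)
    then obtain p where "case_prod heavy p" using \<open>V \<noteq> {}\<close> by fast
    then obtain p where "case_prod heavy p"
      and "\<And>q. case_prod heavy q \<Longrightarrow> card (case_prod comp p) \<le> card (case_prod comp q)"
      using ex_has_least_nat[of "case_prod heavy" p "\<lambda>p. card (case_prod comp p)"] by blast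
    then obtain x z where h: "heavy x z"
      and min: "\<And>x' z'. heavy x' z' \<Longrightarrow> card (comp x z) \<le> card (comp x' z')"
      by (cases p) auto
    have x: "x \<in> V" "z \<in> V - {x}" using h by (auto simp: heavy_def)
    \<comment> \<open>Follow a walk in \<open>T\<close> from \<open>z\<close> to \<open>x\<close>:
      it stays in the component until some node of the component is adjacent to
      \<open>x\<close>.\<close>
    obtain y where y: "y \<in> comp x z" "(y, x) \<in> R"
    proof -
      have "w \<in> comp x z \<or> (\<exists>y\<in>comp x z. (y, x) \<in> R)" if "(z, w) \<in> (Restr R V)\<^sup>*" for w
        using that
      proof (induct rule: rtrancl_induct)
        case base
        then show ?case by (simp add: comp_refl)
      next
        case (step w w')
        then show ?case using comp_sub[OF x(2)] comp_step[of w x z w'] by blast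
      qed
      from this[OF connT] show ?thesis using that x comp_sub[OF x(2)] by blast
    qed
    then have "y \<in> V" using comp_sub[OF x(2)] by blast
    then obtain z' where h': "heavy y z'" using ex by blast
    have z': "z' \<in> V - {y}" using h' by (simp add: heavy_def)
    \<comment> \<open>Two sets that each contain more than half of the vertices must meet.\<close>
    have "P x (comp x z) \<inter> P y (comp y z') \<noteq> {}"
    proof
      assume "P x (comp x z) \<inter> P y (comp y z') = {}"
      then have "card (P x (comp x z)) + card (P y (comp y z')) = card (P x (comp x z) \<union> P y (comp y z'))"
        by (simp add: card_Un_disjoint finP)
      also have "\<dots> \<le> card (pverts G)"
        by (intro card_mono G.pair_finite_verts) (auto simp: P_def)
      finally show False using h h' by (simp add: heavy_def)
    qed
    then obtain v e e' s s' where e: "e \<in> uedges G" "v \<in> e" "e \<notin> A x" "s \<in> comp x z" "e \<in> A s"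
      and e': "e' \<in> uedges G" "v \<in> e'" "e' \<notin> A y" "s' \<in> comp y z'" "e' \<in> A s'"
      by (auto simp: P_def)
    \<comment> \<open>A bag shared by the two edges at \<open>v\<close> gives a node lying in both
      heavy components, from which they can be compared.\<close>
    obtain t where t: "t \<in> V" "e \<in> A t" "e' \<in> A t" using share e e' by blast
    have "s \<in> V" "s' \<in> V" using e(4) e'(4) comp_sub[OF x(2)] comp_sub[OF z'] by auto
    then have "t \<in> comp x s" "t \<in> comp y s'" using same e e' t by blast+
    then have tC: "t \<in> comp x z" and C': "comp y z' = comp y t" 
      using comp_eq e(4) e'(4) by metis+
    have sub: "comp y z' \<subseteq> V - {y}" by (rule comp_sub[OF z'])
    have "w \<in> comp x z" if "(t, w) \<in> (Restr R (V - {y}))\<^sup>*" for w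
      using that
    proof (induct rule: rtrancl_induct)
      case base
      then show ?case by (rule tC)
    next
      case (step w w')
      \<comment> \<open>The walk could leave the component only through \<open>x\<close>. Then
        \<open>w\<close> and \<open>y\<close> would be neighbours of \<open>x\<close> joined within
        \<open>T - x\<close>, hence equal, but the walk avoids \<open>y\<close>.\<close>
      have "w' \<noteq> x"
      proof
        assume "w' = x"
        then have "(x, w) \<in> R" "(x, y) \<in> R" using step(2) y(2) symR by (auto dest: symD)
        moreover have "(y, w) \<in> (Restr R (V - {x}))\<^sup>*"
          using comp_eq[OF y(1)] step(3) by (auto simp: comp_def)
        then have "(y, w) \<in> (Restr R (- {x}))\<^sup>*"
          by (rule rtrancl_mono[THEN subsetD, rotated]) auto
        ultimately have "y = w" using utree_unique_neighbour[OF T] by (simp add: R_def)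
        then show False using step(2) by auto
      qed
      then show ?case using step comp_step[of w x z w'] comp_sub[OF x(2)] by blast
    qed
    then have "comp y z' \<subseteq> comp x z" unfolding C' by (auto simp: comp_def)
    then have "comp y z' \<subset> comp x z" using y(1) sub by blast
    moreover have "finite (comp x z)" using comp_sub[OF x(2)] finV by (auto intro: finite_subset)
    ultimately have "card (comp y z') < card (comp x z)" by (rule psubset_card_mono[rotated])
    then show False using min[OF h'] by simp
  qed
  then obtain x where x: "x \<in> V" "\<And>z. z \<in> V - {x} \<Longrightarrow> 2 * card (P x (comp x z)) \<le> card (pverts G)"
    by blast
  \<comment> \<open>By \<open>meet\<close> all components in this union coincide, so the union names
    the common one without a choice.\<close>
  define D where "D v = (\<Union>z\<in>{z \<in> V. \<exists>e\<in>uedges G. v \<in> e \<and> e \<notin> A x \<and> e \<in> A z}. comp x z)" for v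
  define f where "f v = (if \<exists>e\<in>uedges G. v \<in> e \<and> e \<notin> A x then Inl (D v) else Inr v)" for v :: 'a
  have D: "D v = comp x z" if "e \<in> uedges G" "v \<in> e" "e \<notin> A x" "z \<in> V" "e \<in> A z" for v e z
  proof -
    have "comp x z' = comp x z"
      if "z' \<in> {z \<in> V. \<exists>e\<in>uedges G. v \<in> e \<and> e \<notin> A x \<and> e \<in> A z}" for z'
      using that meet \<open>e \<in> uedges G\<close> \<open>v \<in> e\<close> \<open>e \<notin> A x\<close> \<open>z \<in> V\<close> \<open>e \<in> A z\<close> by blast
    then show ?thesis unfolding D_def using that by blast
  qed
  show thesis
  proof (rule that)
    show "x \<in> pverts T" using x by (simp add: V_def)
  next
    fix u v assume uv: "(u, v) \<in> parcs G" "{u, v} \<notin> A x"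
    then have e: "{u, v} \<in> uedges G" by (auto simp: uedges_def)
    then obtain z where "z \<in> V" "{u, v} \<in> A z" using conn by blast
    then have "D u = comp x z" "D v = comp x z" using D[OF e] uv by auto
    then show "f u = f v" using e uv by (auto simp: f_def)
  next
    fix c
    show "2 * card {v \<in> pverts G. f v = c} \<le> card (pverts G)"
    proof (cases c)
      case (Inr w)
      \<comment> \<open>A part of this kind has at most one vertex, which is at most half because
        \<open>G\<close> has at least two.\<close>
      then have "{v \<in> pverts G. f v = c} \<subseteq> {w}" by (auto simp: f_def split: if_splits)
      then have "card {v \<in> pverts G. f v = c} \<le> 1" using card_mono[of "{w}"] by simp
      then show ?thesis using G(2) by linarith
    next
      case (Inl C)
      show ?thesis
      proof (cases "{v \<in> pverts G. f v = c} = {}")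
        case True
        show ?thesis unfolding True by simp
      next
        case False
        have wit: "\<exists>e z. e \<in> uedges G \<and> v \<in> e \<and> e \<notin> A x \<and> z \<in> V \<and> e \<in> A z \<and> C = comp x z" if "f v = c" for v
        proof -
          have "\<exists>e\<in>uedges G. v \<in> e \<and> e \<notin> A x" and C: "C = D v"
            using that Inl by (auto simp: f_def split: if_splits)
          then obtain e where e: "e \<in> uedges G" "v \<in> e" "e \<notin> A x" by blast
          then obtain z where "z \<in> V" "e \<in> A z" using conn by blast
          then show ?thesis using e C D by blast
        qed
        have "{v \<in> pverts G. f v = c} \<subseteq> P x C"
          using wit comp_refl by (fastforce simp: P_def)
        then have "card {v \<in> pverts G. f v = c} \<le> card (P x C)" by (rule card_mono[OF finP])
        moreover from False wit obtain z where "z \<in> V - {x}" "C = comp x z" by blast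
        ultimately show ?thesis using x(2)[of z] by simp
      qed
    qed
  qed
qed

section \<open>Path decompositions from vertex orderings\<close>

text \<open>Entry \<open>i\<close> of \<open>u # map snd p\<close> is the \<open>i\<close>-th vertex
  visited, which allows arguments by position in a closed walk.\<close>

lemma pcas_walk:
  assumes "pcas u p v"
  shows pawalk_verts_eq: "pawalk_verts u p = u # map snd p"
    and fst_nth_walk: "i < length p \<Longrightarrow> fst (p ! i) = (u # map snd p) ! i"
    and last_walk: "(u # map snd p) ! length p = v"
proof -
  show "pawalk_verts u p = u # map snd p"
    using assms by (induct p arbitrary: u) auto
  show "i < length p \<Longrightarrow> fst (p ! i) = (u # map snd p) ! i"
    using assms by (induct p arbitrary: u i) (auto simp: nth_Cons split: nat.splits)
  show "(u # map snd p) ! length p = v"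
    using assms by (induct p arbitrary: u) auto
qed

text \<open>On a closed walk both neighbours of a largest vertex are exactly one below it, hence
  equal. With three or more arcs they sit at different positions, so the walk is not a
  cycle.\<close>

lemma nat_path_no_cycle:
  fixes T :: "nat pair_pre_digraph"
  assumes T: "parcs T \<subseteq> {(i, j). j = Suc i \<or> i = Suc j}"
    and cyc: "pre_digraph.cycle (with_proj T) p"
  shows "length p < 3"
proof (rule ccontr)
  assume len: "\<not> length p < 3"
  obtain u where p: "pcas u p u" "set p \<subseteq> parcs T" "distinct (tl (pawalk_verts u p))"
    using cyc by (auto simp: pre_digraph.cycle_def pre_digraph.awalk_def cas_with_proj_eq awalk_verts_with_proj_eq)
  define m where "m = length p"
  define f where "f i = snd (p ! i)" for i
  have inj: "i = j" if "f i = f j" "i < m" "j < m" for i j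
    using p(3) that unfolding pawalk_verts_eq[OF p(1)] f_def m_def
    by (metis length_map list.sel(3) nth_eq_iff_index_eq nth_map)
  \<comment> \<open>\<open>f i\<close> is the head of arc \<open>i\<close> and so the tail of the
    next arc in cyclic order; the pair \<open>(m - 1, 0)\<close> is the wrap-around.\<close>
  have step: "f j = Suc (f i) \<or> f i = Suc (f j)" if "(i, j) \<in> {(i, Suc i) | i. Suc i < m} \<union> {(m - 1, 0)}" for i j
  proof -
    have "j < length p" using that len by (auto simp: m_def)
    then have "p ! j \<in> parcs T" using p(2) by auto
    moreover have "fst (p ! j) = f i"
      using fst_nth_walk[OF p(1) \<open>j < length p\<close>] last_walk[OF p(1)] that len
      by (auto simp: f_def m_def nth_Cons split: nat.splits)
    ultimately have "(f i, f j) \<in> parcs T" by (metis f_def prod.collapse)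
    then show ?thesis using T by auto
  qed
  have m: "3 \<le> m" using len by (simp add: m_def)
  have "Max (f ` {..<m}) \<in> f ` {..<m}" using m by (intro Max_in) (auto simp: lessThan_empty_iff)
  then obtain i where i: "i < m" "f i = Max (f ` {..<m})" by auto
  have max: "f j \<le> f i" if "j < m" for j using that by (auto simp: i(2))
  define a where "a = (if i = 0 then m - 1 else i - 1)"
  define b where "b = (if i = m - 1 then 0 else Suc i)"
  have ab: "a < m" "b < m" "a \<noteq> b" using i(1) m by (auto simp: a_def b_def)
  have "(a, i) \<in> {(i, Suc i) | i. Suc i < m} \<union> {(m - 1, 0)}"
    using i(1) by (auto simp: a_def)
  moreover have "(i, b) \<in> {(i, Suc i) | i. Suc i < m} \<union> {(m - 1, 0)}"
    using i(1) by (auto simp: b_def)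
  ultimately have "f a = f b" using step[of a i] step[of i b] max[OF ab(1)] max[OF ab(2)] by linarith
  then show False using inj ab by blast
qed

definition nat_path :: "nat \<Rightarrow> nat pair_pre_digraph" where
  "nat_path m = \<lparr> pverts = {..<m}, 
     parcs = {(i, Suc i) | i. Suc i < m} \<union> {(Suc i, i) | i. Suc i < m} \<rparr>"

lemma pair_graph_nat_path: "pair_graph (nat_path m)"
proof -
  have "finite (parcs (nat_path m))"
    by (rule finite_subset[of _ "{..<m} \<times> {..<m}"]) (auto simp: nat_path_def)
  then show ?thesis
    by unfold_locales (auto simp: nat_path_def symmetric_def intro!: symI)
qed

lemma path_graph_nat_path: "0 < m \<Longrightarrow> path_graph (nat_path m)"
  unfolding path_graph_def
  by (intro exI[of _ "[0..<m]"]) (simp add: nat_path_def atLeast0LessThan cong: rev_conj_cong)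

lemma nat_path_reachable:
  assumes "j < m" "u \<in> {i..j}" "v \<in> {i..j}"
  shows "(u, v) \<in> (Restr (parcs (nat_path m)) {i..j})\<^sup>*"
proof -
  define R where "R = Restr (parcs (nat_path m)) {i..j}"
  have up: "(u, v) \<in> R\<^sup>*" if "u \<le> v" "i \<le> u" "v \<le> j" for u v
    using that
  proof (induct v rule: dec_induct)
    case (step v)
    then have "(v, Suc v) \<in> R" using assms by (auto simp: R_def nat_path_def)
    then show ?case using step by (auto intro: rtrancl_into_rtrancl)
  qed simp
  have "sym R" by (auto simp: R_def nat_path_def intro: symI)
  then show ?thesis
    using up[of u v] up[of v u] assms unfolding R_def[symmetric]
    by (cases "u \<le> v") (auto dest: symD[OF sym_rtrancl])
qed

lemma connected_nat_path_interval:
  assumes "i \<le> j" "j < m"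
  shows "connected (with_proj (nat_path m) \<restriction> {i..j})"
  using assms nat_path_reachable
  by (subst connected_induce_iff[OF pair_graph_nat_path]) (auto simp: nat_path_def)

lemma utree_nat_path:
  assumes "0 < m"
  shows "utree (nat_path m)"
proof -
  have V: "pverts (nat_path m) = {0..m - 1}" using assms by (auto simp: nat_path_def)
  have "connected (with_proj (nat_path m))"
    unfolding connected_iff[OF pair_graph_nat_path] V
    using assms nat_path_reachable[of "m - 1" m] by auto
  moreover have "parcs (nat_path m) \<subseteq> {(i, j). j = Suc i \<or> i = Suc j}"
    by (auto simp: nat_path_def)
  ultimately show ?thesis
    using pair_graph_nat_path nat_path_no_cycle[of "nat_path m"] by (auto simp: utree_def not_le)
qed

text \<open>An edge is placed in all bags from the position of its first end to that of its last, so
  edges with a common vertex meet at the position of that vertex. The edges in bag \<open>p\<close>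
  either end at \<open>xs ! p\<close>, and are counted by its neighbours, or leave the prefix that
  includes \<open>xs ! p\<close>. Edges starting at \<open>xs ! p\<close> may be counted twice,
  which is harmless for an upper bound.\<close>

lemma pathwidth_line_graph_le:
  assumes G: "pair_graph G" and xs: "distinct xs" "set xs = pverts G" "xs \<noteq> []"
    and bound: "\<And>p. p < length xs \<Longrightarrow>
      card {(u, v) \<in> parcs G. u \<in> set (take (Suc p) xs) \<and> v \<notin> set (take (Suc p) xs)}
      + card {u. (u, xs ! p) \<in> parcs G} \<le> M"
  shows "pathwidth (line_graph G) \<le> int M - 1"
proof -
  interpret pair_graph G by fact
  define m where "m = length xs"
  define A where "A p = {e. \<exists>i j. i \<le> p \<and> p \<le> j \<and> j < m \<and> (xs ! i, xs ! j) \<in> parcs G \<and> e = {xs ! i, xs ! j}}" for p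
  have m: "0 < m" using xs by (simp add: m_def)
  have sym: "(v, u) \<in> parcs G" if "(u, v) \<in> parcs G" for u v
    using that pair_sym_arcs by (auto simp: symmetric_def sym_def)
  have norm: "\<exists>i j. i < j \<and> j < m \<and> (xs ! i, xs ! j) \<in> parcs G \<and> e = {xs ! i, xs ! j}"
    if "e \<in> uedges G" for e
  proof -
    from that have "\<exists>u v. (u, v) \<in> parcs G \<and> e = {u, v}" by (auto simp: uedges_def)
    then obtain u v where uv: "(u, v) \<in> parcs G" "e = {u, v}" by blast
    then obtain i j where ij: "i < m" "j < m" "u = xs ! i" "v = xs ! j"
      using in_arcsD1[OF uv(1)] in_arcsD2[OF uv(1)] xs(2) by (metis in_set_conv_nth m_def)
    then have "i \<noteq> j" using pair_no_loops[OF uv(1)] by auto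
    then consider "i < j" | "j < i" by linarith
    then show ?thesis
    proof cases
      case 1
      then show ?thesis using uv ij by blast
    next
      case 2
      then show ?thesis using sym[OF uv(1)] uv(2) ij by (metis insert_commute)
    qed
  qed
  have bags: "{p. p < m \<and> {xs ! i, xs ! j} \<in> A p} = {i..j}"
    if "i < j" "j < m" "(xs ! i, xs ! j) \<in> parcs G" for i j
  proof -
    have "i \<le> p \<and> p \<le> j" if "{xs ! i, xs ! j} \<in> A p" for p
    proof -
      obtain i' j' where "i' \<le> p" "p \<le> j'" "j' < m" "{xs ! i, xs ! j} = {xs ! i', xs ! j'}"
        using \<open>{xs ! i, xs ! j} \<in> A p\<close> by (auto simp: A_def)
      then show ?thesis using \<open>i < j\<close> \<open>j < m\<close> xs(1)
        by (auto simp: doubleton_eq_iff m_def nth_eq_iff_index_eq)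
    qed
    moreover have "{xs ! i, xs ! j} \<in> A p" if "i \<le> p" "p \<le> j" for p
      unfolding A_def using that \<open>j < m\<close> \<open>(xs ! i, xs ! j) \<in> parcs G\<close> by blast
    ultimately have iff: "{xs ! i, xs ! j} \<in> A p \<longleftrightarrow> i \<le> p \<and> p \<le> j" for p by blast
    show ?thesis unfolding iff using \<open>j < m\<close> by auto
  qed
  have "tree_decomposition (line_graph G) (nat_path m) A"
    unfolding tree_decomposition_def
  proof (intro conjI ballI)
    show "utree (nat_path m)" by (rule utree_nat_path[OF m])
  next
    fix p
    show "A p \<subseteq> pverts (line_graph G)" by (auto simp: A_def line_graph_def uedges_def)
  next
    fix e assume "e \<in> pverts (line_graph G)"
    then have "e \<in> uedges G" by (simp add: line_graph_def)
    then obtain i j where "i < j" "j < m" "(xs ! i, xs ! j) \<in> parcs G" "e = {xs ! i, xs ! j}"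
      using norm by blast
    then show "connected (with_proj (nat_path m) \<restriction> {x \<in> pverts (nat_path m). e \<in> A x})"
      using bags connected_nat_path_interval[of i j m] by (simp add: nat_path_def)
  next
    fix ef assume "ef \<in> parcs (line_graph G)"
    then obtain e f v where ef: "ef = (e, f)" "e \<in> uedges G" "f \<in> uedges G" "v \<in> e" "v \<in> f"
      by (auto simp: line_graph_def)
    have "\<exists>u. (u, v) \<in> parcs G" using ef by (auto simp: uedges_def dest: sym)
    then obtain p where p: "p < m" "v = xs ! p" using xs(2) in_arcsD2 by (metis in_set_conv_nth m_def)
    \<comment> \<open>The position of the common vertex is an endpoint of the interval of every edge
      at that vertex.\<close>
    have "g \<in> A p" if g: "g \<in> uedges G" "v \<in> g" for g
    proof -
      obtain i j where ij: "i < j" "j < m" "(xs ! i, xs ! j) \<in> parcs G" "g = {xs ! i, xs ! j}"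
        using norm g(1) by blast
      then have "p = i \<or> p = j" using g(2) p xs(1) by (auto simp: m_def nth_eq_iff_index_eq)
      then have "i \<le> p" "p \<le> j" using ij(1) by auto
      then show ?thesis using ij by (auto simp: A_def)
    qed
    then show "case ef of (e, f) \<Rightarrow> \<exists>x\<in>pverts (nat_path m). e \<in> A x \<and> f \<in> A x"
      using ef p by (auto simp: nat_path_def)
  qed
  then have "pathwidth (line_graph G) \<le> width (nat_path m) A"
    using path_graph_nat_path[OF m] by (rule pathwidth_le)
  also have "width (nat_path m) A \<le> int M - 1"
  proof -
    have "card (A p) \<le> M" if "p < m" for p
    proof -
      let ?P = "set (take (Suc p) xs)"
      let ?C = "{(u, v) \<in> parcs G. u \<in> ?P \<and> v \<notin> ?P}"
      let ?N = "{u. (u, xs ! p) \<in> parcs G}"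
      have fin: "finite ?C" "finite ?N"
        using pair_finite_arcs pair_finite_verts
        by (auto intro: finite_subset[of _ "parcs G"] finite_subset[of _ "pverts G"] dest: in_arcsD1)
      have "A p \<subseteq> (\<lambda>(u, v). {u, v}) ` ?C \<union> (\<lambda>u. {u, xs ! p}) ` ?N"
      proof
        fix e assume "e \<in> A p"
        then obtain i j where ij: "i \<le> p" "p \<le> j" "j < m" "(xs ! i, xs ! j) \<in> parcs G" "e = {xs ! i, xs ! j}"
          by (auto simp: A_def)
        show "e \<in> (\<lambda>(u, v). {u, v}) ` ?C \<union> (\<lambda>u. {u, xs ! p}) ` ?N"
        proof (cases "j = p")
          case True
          then show ?thesis using ij by auto
        next
          case False
          have "xs ! i \<in> ?P" using ij by (auto simp: in_set_conv_nth m_def intro!: exI[of _ i])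
          moreover have "xs ! j \<notin> ?P"
            using False ij xs(1) by (auto simp: in_set_conv_nth m_def nth_eq_iff_index_eq)
          ultimately show ?thesis using ij by auto
        qed
      qed
      then have "card (A p) \<le> card ((\<lambda>(u, v). {u, v}) ` ?C \<union> (\<lambda>u. {u, xs ! p}) ` ?N)"
        using fin by (intro card_mono) auto
      also have "\<dots> \<le> card ((\<lambda>(u, v). {u, v}) ` ?C) + card ((\<lambda>u. {u, xs ! p}) ` ?N)"
        by (rule card_Un_le)
      also have "\<dots> \<le> card ?C + card ?N"
        by (intro add_mono card_image_le fin)
      also have "\<dots> \<le> M" using bound that by (simp add: m_def)
      finally show ?thesis .
    qed
    then have "Max ((\<lambda>p. int (card (A p))) ` {..<m}) \<le> int M"
      using m by (subst Max_le_iff) (auto simp: lessThan_empty_iff)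
    then show ?thesis by (simp add: width_def nat_path_def)
  qed
  finally show ?thesis .
qed

section \<open>Counting edges of complete multipartite graphs\<close>

text \<open>If every \<open>y c\<close> is at most half of the total, bound each factor separately.
  Otherwise one index \<open>d\<close> dominates: all other \<open>y c\<close> are at most the
  remainder, and \<open>half\<close> forces \<open>x d\<close> to be small. In the application
  \<open>x c\<close> and \<open>y c\<close> count the vertices of part \<open>c\<close> inside and
  outside a fixed colour class.\<close>

lemma sum_mult_le_half:
  fixes x y :: "'c \<Rightarrow> real"
  assumes F: "finite F" and x: "\<And>c. c \<in> F \<Longrightarrow> 0 \<le> x c" and y: "\<And>c. c \<in> F \<Longrightarrow> 0 \<le> y c"
    and half: "\<And>c. c \<in> F \<Longrightarrow> x c + y c \<le> (sum x F + sum y F) / 2"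
  shows "(\<Sum>c\<in>F. x c * y c) \<le> sum x F * sum y F / 2"
proof (cases "F = {}")
  case True
  then show ?thesis by simp
next
  case False
  define X where "X = sum x F"
  define Y where "Y = sum y F"
  have "Max (y ` F) \<in> y ` F" using F False by (intro Max_in) auto
  then obtain d where d: "d \<in> F" "y d = Max (y ` F)" by auto
  have max: "y c \<le> y d" if "c \<in> F" for c using that F by (simp add: d(2))
  have X0: "0 \<le> X" unfolding X_def by (rule sum_nonneg[OF x])
  show ?thesis
  proof (cases "y d \<le> Y / 2")
    case True
    have "(\<Sum>c\<in>F. x c * y c) \<le> (\<Sum>c\<in>F. x c * (Y / 2))"
      using True max x by (intro sum_mono mult_left_mono) fastforce+
    also have "\<dots> = X * Y / 2" unfolding X_def by (rule trans[OF sum_distrib_right[symmetric]]) simp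
    finally show ?thesis by (simp add: X_def Y_def)
  next
    case False
    have Xd: "X = x d + sum x (F - {d})" and Yd: "Y = y d + sum y (F - {d})"
      using F d(1) by (simp_all add: X_def Y_def sum.remove)
    have other: "y c \<le> Y - y d" if "c \<in> F - {d}" for c
      using member_le_sum[OF that, of y] F y Yd by auto
    have "(\<Sum>c\<in>F. x c * y c) = x d * y d + (\<Sum>c\<in>F - {d}. x c * y c)"
      using F d(1) by (simp add: sum.remove)
    also have "(\<Sum>c\<in>F - {d}. x c * y c) \<le> (\<Sum>c\<in>F - {d}. x c * (Y - y d))"
      using other x by (intro sum_mono mult_left_mono) auto
    also have "(\<Sum>c\<in>F - {d}. x c * (Y - y d)) = (X - x d) * (Y - y d)"
      by (simp add: Xd sum_distrib_right)
    also have "x d * y d + (X - x d) * (Y - y d) = X * (Y - y d) + x d * (2 * y d - Y)"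
      by (simp add: algebra_simps)
    \<comment> \<open>Replacing \<open>x d\<close> by the largest value that \<open>half\<close>
      allows leaves \<open>X * Y / 2\<close> minus a square.\<close>
    also have "\<dots> \<le> X * (Y - y d) + ((X + Y) / 2 - y d) * (2 * y d - Y)"
      using half[OF d(1)] False unfolding X_def Y_def
      by (intro add_left_mono mult_right_mono) linarith+
    also have "\<dots> = X * Y / 2 - 2 * (y d - Y / 2)\<^sup>2"
      by (simp add: field_simps power2_eq_square)
    also have "\<dots> \<le> X * Y / 2" by simp
    finally show ?thesis by (simp add: X_def Y_def)
  qed
qed

lemma card_eq_sum_card_fibres:
  assumes "finite S" "finite I" "g ` S \<subseteq> I"
  shows "card S = (\<Sum>i\<in>I. card {s \<in> S. g s = i})"
  using sum.group[OF assms, of "\<lambda>_. 1::nat"] by simp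

lemma card_filter_add:
  assumes "finite S"
  shows "card {s \<in> S. Q s} + card {s \<in> S. \<not> Q s} = card S"
proof -
  have "{s \<in> S. Q s} \<union> {s \<in> S. \<not> Q s} = S" by blast
  then show ?thesis
    using assms card_Un_disjoint[of "{s \<in> S. Q s}" "{s \<in> S. \<not> Q s}"] by (simp add: disjoint_iff)
qed

text \<open>Here \<open>g\<close> is the colour and \<open>f\<close> the part. Ordered pairs are
  grouped by the colour of the first vertex; for each colour the claim is
  \<open>sum_mult_le_half\<close> over the parts.\<close>

lemma inside_pairs_le_half:
  assumes V: "finite V" and half: "\<And>c. 2 * card {v \<in> V. f v = c} \<le> card V"
  shows "2 * card {(u, v) \<in> V \<times> V. g u \<noteq> g v \<and> f u = f v} \<le> card {(u, v) \<in> V \<times> V. g u \<noteq> g v}"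
    (is "2 * card ?I \<le> card ?A")
proof -
  have fin: "finite ?I" "finite ?A" using V by (auto intro: finite_subset[of _ "V \<times> V"])
  have each: "2 * card {p \<in> ?I. g (fst p) = i} \<le> card {p \<in> ?A. g (fst p) = i}" for i
  proof -
    define x where "x c = card {v \<in> V. g v = i \<and> f v = c}" for c
    define y where "y c = card {v \<in> V. g v \<noteq> i \<and> f v = c}" for c
    have sx: "sum x (f ` V) = card {v \<in> V. g v = i}"
      by (subst card_eq_sum_card_fibres[of _ "f ` V" f]) (use V in \<open>auto simp: x_def conj_assoc\<close>)
    have sy: "sum y (f ` V) = card {v \<in> V. g v \<noteq> i}"
      by (subst card_eq_sum_card_fibres[of _ "f ` V" f]) (use V in \<open>auto simp: y_def conj_assoc\<close>)
    have "{p \<in> ?A. g (fst p) = i} = {v \<in> V. g v = i} \<times> {v \<in> V. g v \<noteq> i}" by auto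
    then have A: "card {p \<in> ?A. g (fst p) = i} = sum x (f ` V) * sum y (f ` V)"
      by (simp add: card_cartesian_product sx sy)
    have "card {p \<in> ?I. g (fst p) = i} = (\<Sum>c\<in>f ` V. card {p \<in> {p \<in> ?I. g (fst p) = i}. f (fst p) = c})"
      using V fin by (intro card_eq_sum_card_fibres) auto
    also have "\<dots> = (\<Sum>c\<in>f ` V. x c * y c)"
    proof (rule sum.cong[OF refl])
      fix c
      have "{p \<in> {p \<in> ?I. g (fst p) = i}. f (fst p) = c} =
        {v \<in> V. g v = i \<and> f v = c} \<times> {v \<in> V. g v \<noteq> i \<and> f v = c}" by auto
      then show "card {p \<in> {p \<in> ?I. g (fst p) = i}. f (fst p) = c} = x c * y c"
        by (simp add: card_cartesian_product x_def y_def)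
    qed
    finally have I: "card {p \<in> ?I. g (fst p) = i} = (\<Sum>c\<in>f ` V. x c * y c)" .
    have "card {v \<in> V. g v = i} + card {v \<in> V. g v \<noteq> i} = card V"
      using V by (rule card_filter_add)
    then have s: "sum x (f ` V) + sum y (f ` V) = card V" by (simp add: sx sy)
    have xy: "x c + y c = card {v \<in> V. f v = c}" for c
      using V card_filter_add[of "{v \<in> V. f v = c}" "\<lambda>v. g v = i"]
      by (simp add: x_def y_def conj_ac)
    have "real (x c) + real (y c) \<le> ((\<Sum>c\<in>f ` V. real (x c)) + (\<Sum>c\<in>f ` V. real (y c))) / 2" for c
    proof -
      have "2 * (x c + y c) \<le> sum x (f ` V) + sum y (f ` V)" using half by (simp only: xy s)
      then have "real (2 * (x c + y c)) \<le> real (sum x (f ` V) + sum y (f ` V))" by (simp only: of_nat_le_iff)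
      then show ?thesis by simp
    qed
    then have "(\<Sum>c\<in>f ` V. real (x c) * real (y c)) \<le> (\<Sum>c\<in>f ` V. real (x c)) * (\<Sum>c\<in>f ` V. real (y c)) / 2"
      using V by (intro sum_mult_le_half) auto
    then have "real (2 * (\<Sum>c\<in>f ` V. x c * y c)) \<le> real (sum x (f ` V) * sum y (f ` V))" by simp
    then show ?thesis unfolding I A by (simp only: of_nat_le_iff)
  qed
  have "2 * card ?I = (\<Sum>i\<in>g ` V. 2 * card {p \<in> ?I. g (fst p) = i})"
    using V fin by (subst card_eq_sum_card_fibres[of ?I "g ` V" "\<lambda>p. g (fst p)"]) (auto simp: sum_distrib_left)
  also have "\<dots> \<le> (\<Sum>i\<in>g ` V. card {p \<in> ?A. g (fst p) = i})"
    by (rule sum_mono[OF each])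
  also have "\<dots> = card ?A"
    using V fin by (subst card_eq_sum_card_fibres[of ?A "g ` V" "\<lambda>p. g (fst p)"]) auto
  finally show ?thesis .
qed

lemma sum_offdiagonal:
  fixes h :: "nat \<Rightarrow> nat \<Rightarrow> 'c::comm_monoid_add"
  shows "(\<Sum>(i, j)\<in>{(i, j) \<in> {1..k} \<times> {1..k}. i \<noteq> j}. h i j) =
    (\<Sum>(i, j)\<in>{(i, j). 1 \<le> i \<and> i < j \<and> j \<le> k}. h i j + h j i)"
proof -
  define L where "L = {(i::nat, j). 1 \<le> i \<and> i < j \<and> j \<le> k}"
  have fin: "finite L" by (rule finite_subset[of _ "{1..k} \<times> {1..k}"]) (auto simp: L_def)
  have "{(i, j) \<in> {1..k} \<times> {1..k}. i \<noteq> j} = L \<union> prod.swap ` L"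
    by (force simp: L_def image_iff)
  moreover have "L \<inter> prod.swap ` L = {}" by (auto simp: L_def)
  ultimately have "(\<Sum>(i, j)\<in>{(i, j) \<in> {1..k} \<times> {1..k}. i \<noteq> j}. h i j) =
      (\<Sum>(i, j)\<in>L. h i j) + (\<Sum>(i, j)\<in>prod.swap ` L. h i j)"
    using fin by (simp add: sum.union_disjoint)
  also have "(\<Sum>(i, j)\<in>prod.swap ` L. h i j) = (\<Sum>(i, j)\<in>L. h j i)"
    by (subst sum.reindex) (auto simp: inj_on_def case_prod_unfold)
  finally show ?thesis by (simp add: L_def sum.distrib case_prod_unfold)
qed

text \<open>Stated for two sets so that it serves twice: with both equal to the vertex set it counts
  all arcs, and with a set and its complement it counts the arcs of a cut.\<close>

lemma card_pairs_distinct_classes: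
  fixes g :: "'a \<Rightarrow> nat"
  assumes P: "finite P" "g ` P \<subseteq> {1..k}" and Q: "finite Q" "g ` Q \<subseteq> {1..k}"
  shows "card {(u, v) \<in> P \<times> Q. g u \<noteq> g v} =
    (\<Sum>(i, j)\<in>{(i, j). 1 \<le> i \<and> i < j \<and> j \<le> k}.
       card {u \<in> P. g u = i} * card {v \<in> Q. g v = j} + card {u \<in> P. g u = j} * card {v \<in> Q. g v = i})"
proof -
  let ?S = "{(u, v) \<in> P \<times> Q. g u \<noteq> g v}"
  have "card ?S = (\<Sum>ij\<in>{(i, j) \<in> {1..k} \<times> {1..k}. i \<noteq> j}. card {p \<in> ?S. map_prod g g p = ij})"
  proof (rule card_eq_sum_card_fibres)
    show "finite ?S" using P Q by (auto intro: finite_subset[of _ "P \<times> Q"])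
    show "finite {(i, j) \<in> {1..k} \<times> {1..k}. i \<noteq> j}"
      by (rule finite_subset[of _ "{1..k} \<times> {1..k}"]) auto
  qed (use P Q in auto)
  also have "\<dots> = (\<Sum>(i, j)\<in>{(i, j) \<in> {1..k} \<times> {1..k}. i \<noteq> j}. card {u \<in> P. g u = i} * card {v \<in> Q. g v = j})"
  proof (rule sum.cong[OF refl])
    fix ij assume "ij \<in> {(i, j) \<in> {1..k} \<times> {1..k}. i \<noteq> j}"
    then have "{p \<in> ?S. map_prod g g p = ij} = {u \<in> P. g u = fst ij} \<times> {v \<in> Q. g v = snd ij}"
      by auto
    then show "card {p \<in> ?S. map_prod g g p = ij} = (case ij of (i, j) \<Rightarrow> card {u \<in> P. g u = i} * card {v \<in> Q. g v = j})"
      by (simp add: card_cartesian_product case_prod_unfold)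
  qed
  also note sum_offdiagonal
  finally show ?thesis .
qed

text \<open>Each index lies in \<open>k - 1\<close> pairs. With \<open>n\<close> constantly 1 this
  also counts the pairs.\<close>

lemma sum_pairs_add:
  fixes n :: "nat \<Rightarrow> real"
  assumes "1 \<le> k"
  shows "(\<Sum>(i, j)\<in>{(i, j). 1 \<le> i \<and> i < j \<and> j \<le> k}. n i + n j) = (real k - 1) * (\<Sum>i=1..k. n i)"
proof -
  have "(\<Sum>(i, j)\<in>{(i, j). 1 \<le> i \<and> i < j \<and> j \<le> k}. n i + n j) =
      (\<Sum>(i, j)\<in>{(i, j) \<in> {1..k} \<times> {1..k}. i \<noteq> j}. n i)"
    by (rule sum_offdiagonal[symmetric])
  also have "{(i, j) \<in> {1..k} \<times> {1..k}. i \<noteq> j} = (SIGMA i:{1..k}. {1..k} - {i})" by auto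
  also have "(\<Sum>(i, j)\<in>(SIGMA i:{1..k}. {1..k} - {i}). n i) = (\<Sum>i=1..k. (real k - 1) * n i)"
    by (subst sum.Sigma[symmetric]) (use assms in \<open>auto intro!: sum.cong simp: of_nat_diff\<close>)
  finally show ?thesis by (simp add: sum_distrib_left)
qed

section \<open>Rounding errors of evenly spread colour classes\<close>

text \<open>\<open>U\<close> is an initial segment of \<open>{1..m}\<close> cut at
  \<open>\<tau>\<close>, with a tie \<open>2 * a - 1 = \<tau>\<close> going either way. Its largest
  element bounds its size from above, and the first missing element bounds it from below.\<close>

lemma card_interval_approx:
  fixes \<tau> :: real
  assumes U: "U \<subseteq> {1..m}" and le: "\<And>a. a \<in> U \<Longrightarrow> 2 * real a - 1 \<le> \<tau>"
    and ge: "\<And>a. a \<in> {1..m} - U \<Longrightarrow> \<tau> \<le> 2 * real a - 1"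
    and \<tau>: "0 \<le> \<tau>" "\<tau> \<le> 2 * real m"
  shows "\<bar>2 * real (card U) - \<tau>\<bar> \<le> 1"
proof -
  have fin: "finite U" using U by (rule finite_subset) simp
  have "2 * real (card U) \<le> \<tau> + 1"
  proof (cases "U = {}")
    case True
    then show ?thesis using \<tau> by simp
  next
    case False
    have "U \<subseteq> {1..Max U}" using U fin by auto
    then have "card U \<le> Max U" using card_mono[of "{1..Max U}" U] by simp
    then show ?thesis using le[OF Max_in[OF fin False]] by linarith
  qed
  moreover have "\<tau> - 1 \<le> 2 * real (card U)"
  proof (cases "U = {1..m}")
    case True
    then show ?thesis using \<tau> by simp
  next
    case False
    then have ne: "{1..m} - U \<noteq> {}" using U by auto
    define a where "a = Min ({1..m} - U)"
    have a: "a \<in> {1..m} - U" unfolding a_def using ne by (intro Min_in) auto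
    have "{1..<a} \<subseteq> U"
    proof
      fix b assume b: "b \<in> {1..<a}"
      show "b \<in> U"
      proof (rule ccontr)
        assume "b \<notin> U"
        then have "a \<le> b" unfolding a_def using a b by (intro Min_le) auto
        then show False using b by simp
      qed
    qed
    then have "a - 1 \<le> card U" using card_mono[OF fin, of "{1..<a}"] by simp
    then show ?thesis using ge[OF a] a by (simp add: of_nat_diff)
  qed
  ultimately show ?thesis by linarith
qed

text \<open>Write \<open>a\<close> and \<open>b\<close> as the shares \<open>t * n / 2\<close> and
  \<open>t * n' / 2\<close> plus errors \<open>d / 2\<close> and \<open>e / 2\<close>. After
  expansion the main term is at most its value at \<open>t = 1\<close>, the terms linear in the
  errors carry the factor \<open>1 - t\<close> of modulus at most 1, and \<open>d * e\<close> is at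
  most 1 in modulus.\<close>

lemma crossing_pair_le:
  fixes a b t n n' :: real
  assumes t: "0 \<le> t" "t \<le> 2" and n: "0 \<le> n" "0 \<le> n'"
    and a: "\<bar>2 * a - t * n\<bar> \<le> 1" and b: "\<bar>2 * b - t * n'\<bar> \<le> 1"
  shows "a * (n' - b) + b * (n - a) \<le> 1 / 2 * (n * n') + 1 / 2 * (n + n') + 1 / 2"
proof -
  define d where "d = 2 * a - t * n"
  define e where "e = 2 * b - t * n'"
  have de: "\<bar>d\<bar> \<le> 1" "\<bar>e\<bar> \<le> 1" using a b by (simp_all add: d_def e_def)
  have ab: "a = (t * n + d) / 2" "b = (t * n' + e) / 2" by (simp_all add: d_def e_def)
  have "4 * (a * (n' - b) + b * (n - a)) =
      2 * (t * (2 - t) * (n * n')) + 2 * ((1 - t) * (d * n' + e * n)) - 2 * (d * e)"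
    unfolding ab by (simp add: field_simps)
  also have "\<dots> \<le> 2 * (n * n') + 2 * (n + n') + 2"
  proof -
    have "t * (2 - t) \<le> 1" using zero_le_power2[of "t - 1"] by (simp add: power2_eq_square algebra_simps)
    then have 1: "(t * (2 - t)) * (n * n') \<le> 1 * (n * n')" using n by (intro mult_right_mono) auto
    have "\<bar>d * n' + e * n\<bar> \<le> \<bar>d\<bar> * n' + \<bar>e\<bar> * n"
      using abs_triangle_ineq[of "d * n'" "e * n"] n by (simp add: abs_mult)
    also have "\<dots> \<le> 1 * n' + 1 * n" using de n by (intro add_mono mult_right_mono) auto
    finally have "\<bar>(1 - t) * (d * n' + e * n)\<bar> \<le> 1 * (n' + n)"
      unfolding abs_mult using t by (intro mult_mono) auto
    then have 2: "(1 - t) * (d * n' + e * n) \<le> 1 * (n' + n)" by (rule order.trans[OF abs_ge_self])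
    have "\<bar>d * e\<bar> \<le> 1 * 1" unfolding abs_mult using de by (intro mult_mono) auto
    then have "- (d * e) \<le> 1 * 1" by (rule order.trans[OF abs_ge_minus_self])
    \<comment> \<open>The products are generalised to variables, which makes the final combination
      linear.\<close>
    moreover have "2 * p + 2 * q - 2 * r \<le> 2 * s + 2 * (n + n') + 2"
      if "p \<le> 1 * s" "q \<le> 1 * (n' + n)" "- r \<le> 1 * 1" for p q r s
      using that by argo
    ultimately show ?thesis using 1 2 by blast
  qed
  finally show ?thesis by argo
qed

section \<open>The lower bound on treewidth\<close>

lemma width_ge_card_bag:
  assumes "utree T" "x \<in> pverts T"
  shows "int (card (A x)) - 1 \<le> width T A"
proof -
  interpret pair_graph T using assms by (simp add: utree_def)
  have "int (card (A x)) \<le> Max ((\<lambda>x. int (card (A x))) ` pverts T)"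
    using assms by (intro Max_ge) (auto simp: pair_finite_verts)
  then show ?thesis by (simp add: width_def)
qed

lemma treewidth_le_pathwidth:
  assumes "pair_graph G"
  shows "treewidth G \<le> pathwidth G"
  using pathwidth_attained[OF assms] treewidth_le by metis

text \<open>An unordered pair arises from at most two ordered ones. If \<open>S\<close> is infinite,
  its \<open>card\<close> is 0.\<close>

lemma card_arcs_le_two_card_edges:
  assumes "finite E" "\<And>u v. (u, v) \<in> S \<Longrightarrow> {u, v} \<in> E"
  shows "card S \<le> 2 * card E"
proof (cases "finite S")
  case True
  have "card S = (\<Sum>e\<in>E. card {p \<in> S. {fst p, snd p} = e})"
    using True assms by (intro card_eq_sum_card_fibres) auto
  also have "\<dots> \<le> (\<Sum>e\<in>E. 2)"
  proof (rule sum_mono)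
    fix e
    show "card {p \<in> S. {fst p, snd p} = e} \<le> 2"
    proof (cases "\<exists>p\<in>S. {fst p, snd p} = e")
      case True
      then obtain a b where "e = {a, b}" by auto
      then have "{p \<in> S. {fst p, snd p} = e} \<subseteq> set [(a, b), (b, a)]"
        by (auto simp: doubleton_eq_iff)
      then have "card {p \<in> S. {fst p, snd p} = e} \<le> card (set [(a, b), (b, a)])"
        by (intro card_mono) auto
      also have "\<dots> \<le> 2" using card_length[of "[(a, b), (b, a)]"] by simp
      finally show ?thesis .
    next
      case False
      then have none: "{p \<in> S. {fst p, snd p} = e} = {}" by blast
      show ?thesis unfolding none by simp
    qed
  qed
  finally show ?thesis by simp
qed simp

lemma card_class_multipartite:
  assumes "i \<in> {1..k}"
  shows "card {v \<in> pverts (complete_multipartite k n). fst v = i} = n i"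
proof -
  have "{v \<in> pverts (complete_multipartite k n). fst v = i} = {i} \<times> {1..n i}"
    using assms by (auto simp: complete_multipartite_def)
  then show ?thesis by (simp add: card_cartesian_product)
qed

lemma card_arcs_multipartite:
  "card (parcs (complete_multipartite k n)) = 2 * (\<Sum>(i, j)\<in>{(i, j). 1 \<le> i \<and> i < j \<and> j \<le> k}. n i * n j)"
proof -
  let ?V = "pverts (complete_multipartite k n)"
  have fin: "finite ?V" by (simp add: complete_multipartite_def)
  have g: "fst ` ?V \<subseteq> {1..k}" by (auto simp: complete_multipartite_def)
  have arcs: "parcs (complete_multipartite k n) = {(u, v) \<in> ?V \<times> ?V. fst u \<noteq> fst v}"
    by (auto simp: complete_multipartite_def)
  have "card (parcs (complete_multipartite k n)) = (\<Sum>(i, j)\<in>{(i, j). 1 \<le> i \<and> i < j \<and> j \<le> k}.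
      card {u \<in> ?V. fst u = i} * card {v \<in> ?V. fst v = j} + card {u \<in> ?V. fst u = j} * card {v \<in> ?V. fst v = i})"
    unfolding arcs by (rule card_pairs_distinct_classes[OF fin g fin g])
  also have "\<dots> = (\<Sum>(i, j)\<in>{(i, j). 1 \<le> i \<and> i < j \<and> j \<le> k}. 2 * (n i * n j))"
    by (intro sum.cong) (auto simp: card_class_multipartite)
  finally show ?thesis by (simp add: sum_distrib_left case_prod_unfold)
qed

text \<open>There are \<open>2 * E\<close> arcs, of which at least \<open>E\<close> join different
  parts of the balanced partition. The corresponding edges all lie in one bag, and each accounts for
  at most two arcs, so that bag has at least \<open>E / 2\<close> elements.\<close>

lemma treewidth_line_graph_multipartite_ge:
  assumes "2 \<le> card (pverts (complete_multipartite k n))"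
  shows "(\<Sum>(i, j)\<in>{(i, j). 1 \<le> i \<and> i < j \<and> j \<le> k}. real (n i) * real (n j)) / 2 - 1
    \<le> real_of_int (treewidth (line_graph (complete_multipartite k n)))"
proof -
  define G where "G = complete_multipartite k n"
  define E where "E = (\<Sum>(i, j)\<in>{(i, j). 1 \<le> i \<and> i < j \<and> j \<le> k}. n i * n j)"
  have G: "pair_graph G" unfolding G_def by (rule pair_graph_complete_multipartite)
  then interpret pair_graph G .
  obtain T :: "nat pair_pre_digraph" and A where
    dec: "tree_decomposition (line_graph G) T A" and w: "width T A = treewidth (line_graph G)"
    using treewidth_attained[OF pair_graph_line_graph[OF G]] by blast
  have "2 \<le> card (pverts G)" using assms by (simp add: G_def)
  from balanced_bag[OF G this dec]
  obtain x and f :: "nat \<times> nat \<Rightarrow> nat set + nat \<times> nat" where x: "x \<in> pverts T"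
    and f: "\<And>u v. (u, v) \<in> parcs G \<Longrightarrow> {u, v} \<notin> A x \<Longrightarrow> f u = f v"
    and half: "\<And>c. 2 * card {v \<in> pverts G. f v = c} \<le> card (pverts G)"
    by blast
  let ?I = "{(u, v) \<in> parcs G. f u = f v}"
  let ?C = "{(u, v) \<in> parcs G. f u \<noteq> f v}"
  have "2 * card {(u, v) \<in> pverts G \<times> pverts G. fst u \<noteq> fst v \<and> f u = f v}
      \<le> card {(u, v) \<in> pverts G \<times> pverts G. fst u \<noteq> fst v}"
    by (rule inside_pairs_le_half[OF pair_finite_verts half])
  also have "{(u, v) \<in> pverts G \<times> pverts G. fst u \<noteq> fst v \<and> f u = f v} = ?I"
    by (auto simp: G_def complete_multipartite_def)
  also have "{(u, v) \<in> pverts G \<times> pverts G. fst u \<noteq> fst v} = parcs G"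
    by (auto simp: G_def complete_multipartite_def)
  finally have "2 * card ?I \<le> card (parcs G)" .
  moreover have "card ?I + card ?C = card (parcs G)"
    using card_filter_add[OF pair_finite_arcs, of "\<lambda>(u, v). f u = f v"] by (simp add: case_prod_unfold)
  ultimately have "card (parcs G) \<le> 2 * card ?C" by linarith
  then have "E \<le> card ?C" using card_arcs_multipartite[of k n] by (simp add: G_def E_def)
  also have "card ?C \<le> 2 * card (A x)"
  proof (rule card_arcs_le_two_card_edges)
    have "A x \<subseteq> uedges G"
      using dec x by (auto simp: tree_decomposition_def line_graph_def)
    moreover have "uedges G = (\<lambda>(u, v). {u, v}) ` parcs G" by (auto simp: uedges_def)
    ultimately show "finite (A x)" using pair_finite_arcs by (simp add: finite_subset)
  qed (use f in blast)
  finally have "real E / 2 \<le> real (card (A x))" by simp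
  moreover have "int (card (A x)) - 1 \<le> treewidth (line_graph G)"
    using width_ge_card_bag[OF _ x] dec w by (metis tree_decomposition_def)
  moreover have "real E = (\<Sum>(i, j)\<in>{(i, j). 1 \<le> i \<and> i < j \<and> j \<le> k}. real (n i) * real (n j))"
    by (simp add: E_def case_prod_unfold)
  ultimately show ?thesis unfolding G_def by linarith
qed

section \<open>The upper bound on pathwidth\<close>

text \<open>Sum \<open>crossing_pair_le\<close> over all pairs of colour classes, with the same
  \<open>t\<close> for every class.\<close>

lemma crossing_prefix_multipartite_le:
  assumes k: "1 \<le> k" and P: "P \<subseteq> pverts (complete_multipartite k n)"
    and t: "0 \<le> t" "t \<le> 2"
    and bal: "\<And>i. i \<in> {1..k} \<Longrightarrow> \<bar>2 * real (card {v \<in> P. fst v = i}) - t * real (n i)\<bar> \<le> 1"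
  shows "real (card {(u, v) \<in> parcs (complete_multipartite k n). u \<in> P \<and> v \<notin> P})
    \<le> 1 / 2 * (\<Sum>(i, j)\<in>{(i, j). 1 \<le> i \<and> i < j \<and> j \<le> k}. real (n i) * real (n j))
      + 1 / 2 * ((real k - 1) * (\<Sum>i=1..k. real (n i))) + 1 / 4 * (real k * (real k - 1))"
proof -
  let ?V = "pverts (complete_multipartite k n)"
  let ?L = "{(i, j). 1 \<le> i \<and> i < j \<and> j \<le> k}"
  define a where "a i = card {v \<in> P. fst v = i}" for i
  have fin: "finite ?V" by (simp add: complete_multipartite_def)
  have g: "fst ` ?V \<subseteq> {1..k}" by (auto simp: complete_multipartite_def)
  have finP: "finite P" "fst ` P \<subseteq> {1..k}" using P fin g by (auto intro: finite_subset)
  have finQ: "finite (?V - P)" "fst ` (?V - P) \<subseteq> {1..k}" using fin g by auto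
  have b: "real (card {v \<in> ?V - P. fst v = i}) = real (n i) - real (a i)" if "i \<in> {1..k}" for i
  proof -
    have "{v \<in> {v \<in> ?V. fst v = i}. v \<in> P} = {v \<in> P. fst v = i}"
      and "{v \<in> {v \<in> ?V. fst v = i}. v \<notin> P} = {v \<in> ?V - P. fst v = i}"
      using P by blast+
    then have "a i + card {v \<in> ?V - P. fst v = i} = card {v \<in> ?V. fst v = i}"
      using card_filter_add[of "{v \<in> ?V. fst v = i}" "\<lambda>v. v \<in> P"] fin by (simp add: a_def)
    then show ?thesis using card_class_multipartite[OF that] by simp
  qed
  have "{(u, v) \<in> parcs (complete_multipartite k n). u \<in> P \<and> v \<notin> P} = {(u, v) \<in> P \<times> (?V - P). fst u \<noteq> fst v}"
    using P by (auto simp: complete_multipartite_def)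
  then have "real (card {(u, v) \<in> parcs (complete_multipartite k n). u \<in> P \<and> v \<notin> P})
    = real (\<Sum>(i, j)\<in>?L. a i * card {v \<in> ?V - P. fst v = j} + a j * card {v \<in> ?V - P. fst v = i})"
    using card_pairs_distinct_classes[OF finP finQ] by (simp add: a_def)
  also have "\<dots> = (\<Sum>(i, j)\<in>?L. real (a i) * real (card {v \<in> ?V - P. fst v = j}) + real (a j) * real (card {v \<in> ?V - P. fst v = i}))"
    by (simp add: case_prod_unfold)
  also have "\<dots> \<le> (\<Sum>(i, j)\<in>?L. 1 / 2 * (real (n i) * real (n j)) + 1 / 2 * (real (n i) + real (n j)) + 1 / 2)"
  proof (rule sum_mono)
    fix p assume "p \<in> ?L"
    then obtain i j where p: "p = (i, j)" "i \<in> {1..k}" "j \<in> {1..k}" by auto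
    show "(case p of (i, j) \<Rightarrow> real (a i) * real (card {v \<in> ?V - P. fst v = j}) + real (a j) * real (card {v \<in> ?V - P. fst v = i}))
      \<le> (case p of (i, j) \<Rightarrow> 1 / 2 * (real (n i) * real (n j)) + 1 / 2 * (real (n i) + real (n j)) + 1 / 2)"
      unfolding p(1) prod.case b[OF p(2)] b[OF p(3)]
      using bal[OF p(2)] bal[OF p(3)] t by (intro crossing_pair_le) (auto simp: a_def)
  qed
  \<comment> \<open>The constant \<open>1 / 2\<close> is split as \<open>1 / 4 * (1 + 1)\<close> so
    that \<open>sum_pairs_add\<close> evaluates its sum as well.\<close>
  also have "\<dots> = 1 / 2 * (\<Sum>(i, j)\<in>?L. real (n i) * real (n j)) + 1 / 2 * (\<Sum>(i, j)\<in>?L. real (n i) + real (n j))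
      + 1 / 4 * (\<Sum>(i, j)\<in>?L. 1 + 1)"
    unfolding case_prod_unfold sum_distrib_left sum.distrib[symmetric] by (intro sum.cong refl) simp
  also have "(\<Sum>(i, j)\<in>?L. real (n i) + real (n j)) = (real k - 1) * (\<Sum>i=1..k. real (n i))"
    by (rule sum_pairs_add[OF k])
  also have "(\<Sum>(i, j)\<in>?L. 1 + 1) = (real k - 1) * (\<Sum>i=1..k. 1)"
    by (rule sum_pairs_add[OF k, of "\<lambda>_. 1"])
  finally show ?thesis by (simp add: mult.commute)
qed

text \<open>Sort the vertices by \<open>key\<close> and let \<open>t\<close> be the key of the last
  vertex of the prefix. In class \<open>i\<close> the prefix then consists of the \<open>a\<close>
  with \<open>2 * a - 1\<close> below \<open>t * n i\<close>, up to ties, so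
  \<open>card_interval_approx\<close> applies.\<close>

lemma balanced_order_multipartite:
  assumes n: "\<forall>i\<in>{1..k}. 1 \<le> n i"
  obtains xs where "distinct xs" "set xs = pverts (complete_multipartite k n)"
    and "\<And>p. p < length xs \<Longrightarrow> \<exists>t. 0 \<le> t \<and> t \<le> 2 \<and> (\<forall>i\<in>{1..k}.
      \<bar>2 * real (card {v \<in> set (take (Suc p) xs). fst v = i}) - t * real (n i)\<bar> \<le> 1)"
proof -
  let ?V = "pverts (complete_multipartite k n)"
  have V: "?V = (SIGMA i:{1..k}. {1..n i})" by (simp add: complete_multipartite_def)
  \<comment> \<open>the midpoints of the \<open>n i\<close> equal subintervals of \<open>[0, 2]\<close>\<close>
  define key where "key v = (2 * real (snd v) - 1) / real (n (fst v))" for v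
  have "finite ?V" by (simp add: V)
  then obtain ys where "distinct ys" "set ys = ?V" using finite_distinct_list by blast
  define xs where "xs = sort_key key ys"
  have xs: "distinct xs" "set xs = ?V" "sorted (map key xs)"
    using \<open>distinct ys\<close> \<open>set ys = ?V\<close> by (simp_all add: xs_def)
  show thesis
  proof (rule that[OF xs(1,2)])
    fix p assume p: "p < length xs"
    define P where "P = set (take (Suc p) xs)"
    define t where "t = key (xs ! p)"
    have PV: "P \<subseteq> ?V" unfolding P_def xs(2)[symmetric] by (rule set_take_subset)
    have le: "key v \<le> t" if "v \<in> P" for v
    proof -
      have "\<exists>q\<le>p. v = xs ! q"
        using \<open>v \<in> P\<close> by (auto simp: P_def in_set_conv_nth less_Suc_eq_le)
      then obtain q where "q \<le> p" "v = xs ! q" by blast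
      then show ?thesis using sorted_nth_mono[OF xs(3), of q p] p by (simp add: t_def)
    qed
    have ge: "t \<le> key v" if "v \<in> ?V - P" for v
    proof -
      have "v \<in> set xs" "v \<notin> P" using that xs(2) by auto
      then obtain q where q: "q < length xs" "v = xs ! q" by (metis in_set_conv_nth)
      have "p < q"
      proof (rule ccontr)
        assume "\<not> p < q"
        then have "v \<in> P" using q p by (auto simp: P_def in_set_conv_nth intro!: exI[of _ q])
        then show False using \<open>v \<notin> P\<close> by simp
      qed
      then show ?thesis using sorted_nth_mono[OF xs(3), of p q] q by (simp add: t_def)
    qed
    have "xs ! p \<in> ?V" using p xs(2) nth_mem by blast
    then obtain i a where ia: "xs ! p = (i, a)" "i \<in> {1..k}" "1 \<le> a" "a \<le> n i" by (auto simp: V)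
    have "0 \<le> t" "t \<le> 2" using ia n by (auto simp: t_def key_def field_simps)
    moreover have "\<bar>2 * real (card {v \<in> P. fst v = i}) - t * real (n i)\<bar> \<le> 1" if i: "i \<in> {1..k}" for i
    proof -
      define U where "U = {a. (i, a) \<in> P}"
      have ni: "0 < real (n i)" using n i by force
      have "{v \<in> P. fst v = i} = Pair i ` U" by (auto simp: U_def)
      then have "card {v \<in> P. fst v = i} = card U" by (simp add: card_image inj_on_def)
      moreover have "\<bar>2 * real (card U) - t * real (n i)\<bar> \<le> 1"
      proof (rule card_interval_approx)
        show "U \<subseteq> {1..n i}" using PV by (auto simp: U_def V)
      next
        fix a assume "a \<in> U"
        then have "key (i, a) \<le> t" by (intro le) (simp add: U_def)
        then show "2 * real a - 1 \<le> t * real (n i)" using ni by (simp add: key_def field_simps)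
      next
        fix a assume "a \<in> {1..n i} - U"
        then have "t \<le> key (i, a)" using i by (intro ge) (simp add: U_def V)
        then show "t * real (n i) \<le> 2 * real a - 1" using ni by (simp add: key_def field_simps)
      next
        show "0 \<le> t * real (n i)" using \<open>0 \<le> t\<close> by simp
        show "t * real (n i) \<le> 2 * real (n i)" using \<open>t \<le> 2\<close> by (intro mult_right_mono) auto
      qed
      ultimately show ?thesis by simp
    qed
    ultimately show "\<exists>t. 0 \<le> t \<and> t \<le> 2 \<and> (\<forall>i\<in>{1..k}.
      \<bar>2 * real (card {v \<in> set (take (Suc p) xs). fst v = i}) - t * real (n i)\<bar> \<le> 1)"
      unfolding P_def by blast
  qed
qed

text \<open>A bag has at most as many edges as leave the prefix plus the degree of its last vertex,
  which is at most \<open>N - 1\<close>; passing from bag size to width subtracts one more.\<close>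

lemma pathwidth_line_graph_multipartite_le:
  assumes k: "1 \<le> k" and n: "\<forall>i\<in>{1..k}. 1 \<le> n i"
  defines "N \<equiv> \<Sum>i=1..k. real (n i)"
  shows "real_of_int (pathwidth (line_graph (complete_multipartite k n)))
    \<le> 1 / 2 * (\<Sum>(i, j)\<in>{(i, j). 1 \<le> i \<and> i < j \<and> j \<le> k}. real (n i) * real (n j))
      + 1 / 2 * ((real k - 1) * N) + 1 / 4 * (real k * (real k - 1)) + N - 2"
    (is "_ \<le> ?B + N - 2")
proof -
  define G where "G = complete_multipartite k n"
  have G: "pair_graph G" unfolding G_def by (rule pair_graph_complete_multipartite)
  then interpret pair_graph G .
  have cardV: "real (card (pverts G)) = N"
    unfolding G_def card_verts_complete_multipartite by (simp add: N_def)
  obtain xs where xs: "distinct xs" "set xs = pverts G"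
    and bal: "\<And>p. p < length xs \<Longrightarrow> \<exists>t. 0 \<le> t \<and> t \<le> 2 \<and> (\<forall>i\<in>{1..k}.
      \<bar>2 * real (card {v \<in> set (take (Suc p) xs). fst v = i}) - t * real (n i)\<bar> \<le> 1)"
    using balanced_order_multipartite[OF n] unfolding G_def by blast
  have "(1, 1) \<in> pverts G" using k n by (auto simp: G_def complete_multipartite_def)
  then have "xs \<noteq> []" using xs by auto
  have "pathwidth (line_graph G) \<le> int (nat \<lfloor>?B + N - 1\<rfloor>) - 1"
  proof (rule pathwidth_line_graph_le[OF G xs \<open>xs \<noteq> []\<close>])
    fix p assume p: "p < length xs"
    let ?P = "set (take (Suc p) xs)"
    have "?P \<subseteq> pverts G" unfolding xs(2)[symmetric] by (rule set_take_subset)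
    then have C: "real (card {(u, v) \<in> parcs G. u \<in> ?P \<and> v \<notin> ?P}) \<le> ?B"
      using bal[OF p] crossing_prefix_multipartite_le[OF k] unfolding G_def N_def by blast
    have "xs ! p \<in> pverts G" using p xs(2) nth_mem by blast
    have "{u. (u, xs ! p) \<in> parcs G} \<subseteq> pverts G - {xs ! p}"
      using in_arcsD1 pair_no_loops by fastforce
    then have "card {u. (u, xs ! p) \<in> parcs G} \<le> card (pverts G - {xs ! p})"
      using pair_finite_verts by (intro card_mono) auto
    also have "\<dots> = card (pverts G) - 1" using \<open>xs ! p \<in> pverts G\<close> by (simp add: card_Diff_singleton)
    finally have "card {u. (u, xs ! p) \<in> parcs G} + 1 \<le> card (pverts G)"
      using card_gt_0_iff[of "pverts G"] pair_finite_verts \<open>xs ! p \<in> pverts G\<close> by auto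
    then have "real (card {u. (u, xs ! p) \<in> parcs G}) \<le> N - 1"
      unfolding cardV[symmetric] by linarith
    with C show "card {(u, v) \<in> parcs G. u \<in> ?P \<and> v \<notin> ?P} + card {u. (u, xs ! p) \<in> parcs G}
        \<le> nat \<lfloor>?B + N - 1\<rfloor>"
      by (subst le_nat_floor) auto
  qed
  \<comment> \<open>Nonnegativity ensures that \<open>nat\<close> does not truncate the floor, so
    the natural bound is at most the real one.\<close>
  moreover have "0 \<le> ?B + N - 1"
  proof -
    have "pverts G \<noteq> {}" using \<open>(1, 1) \<in> pverts G\<close> by auto
    then have "1 \<le> card (pverts G)" using pair_finite_verts by (simp add: Suc_leI card_gt_0_iff)
    then have "1 \<le> N" unfolding cardV[symmetric] by simp
    moreover have "0 \<le> ?B" using k \<open>1 \<le> N\<close>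
      by (intro add_nonneg_nonneg mult_nonneg_nonneg sum_nonneg) auto
    ultimately show ?thesis by linarith
  qed
  ultimately show ?thesis unfolding G_def by linarith
qed

section \<open>Comparison with the stated bounds\<close>

theorem theorem2:
  fixes k N :: nat and n :: "nat \<Rightarrow> nat"
  assumes "k \<ge> 2"
    and "\<forall>i\<in>{1..k}. n i \<ge> 1"
    and "N = (\<Sum>i=1..k. n i)"
  shows "- real N * (real k - 1) + 3 / 4 * real k * (real k - 1) - 1
           + 1 / 2 * (\<Sum>(i, j)\<in>{(i, j). 1 \<le> i \<and> i < j \<and> j \<le> k}. real (n i) * real (n j))
         \<le> real_of_int (treewidth (line_graph (complete_multipartite k n)))
       \<and> treewidth (line_graph (complete_multipartite k n))
         \<le> pathwidth (line_graph (complete_multipartite k n))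
       \<and> real_of_int (pathwidth (line_graph (complete_multipartite k n)))
         \<le> 1 / 2 * real N * (real k + 5) + 1 / 4 * real k * (real k - 1) - 4
           + 1 / 2 * (\<Sum>(i, j)\<in>{(i, j). 1 \<le> i \<and> i < j \<and> j \<le> k}. real (n i) * real (n j))"
proof (intro conjI)
  let ?E = "\<Sum>(i, j)\<in>{(i, j). 1 \<le> i \<and> i < j \<and> j \<le> k}. real (n i) * real (n j)"
  have "(\<Sum>i=1..k. 1) \<le> (\<Sum>i=1..k. n i)"
    using assms(2) by (intro sum_mono) auto
  then have kN: "k \<le> N" using assms(3) by simp
  \<comment> \<open>This product is the difference between the stated lower bound and
    \<open>?E / 2 - 1\<close>; it is nonpositive since every class is nonempty, so that
    \<open>k \<le> N\<close>.\<close>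
  have "(real k - 1) * (3 / 4 * real k - real N) \<le> 0"
    using kN assms(1) by (intro mult_nonneg_nonpos) auto
  moreover have "?E / 2 - 1 \<le> real_of_int (treewidth (line_graph (complete_multipartite k n)))"
    using kN assms by (intro treewidth_line_graph_multipartite_ge) (simp add: card_verts_complete_multipartite)
  ultimately show "- real N * (real k - 1) + 3 / 4 * real k * (real k - 1) - 1 + 1 / 2 * ?E
      \<le> real_of_int (treewidth (line_graph (complete_multipartite k n)))"
    by (simp add: algebra_simps)
  show "treewidth (line_graph (complete_multipartite k n)) \<le> pathwidth (line_graph (complete_multipartite k n))"
    by (intro treewidth_le_pathwidth pair_graph_line_graph pair_graph_complete_multipartite)
  have "real_of_int (pathwidth (line_graph (complete_multipartite k n)))
      \<le> 1 / 2 * ?E + 1 / 2 * ((real k - 1) * real N) + 1 / 4 * (real k * (real k - 1)) + real N - 2"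
    using pathwidth_line_graph_multipartite_le[of k n] assms by simp
  also have "\<dots> \<le> 1 / 2 * real N * (real k + 5) + 1 / 4 * real k * (real k - 1) - 4 + 1 / 2 * ?E"
  proof -
    \<comment> \<open>The stated upper bound exceeds the one obtained by exactly
      \<open>2 * N - 2\<close>.\<close>
    have "1 \<le> real N" using kN assms(1) by simp
    then show ?thesis by (simp add: field_simps)
  qed
  finally show "real_of_int (pathwidth (line_graph (complete_multipartite k n)))
      \<le> 1 / 2 * real N * (real k + 5) + 1 / 4 * real k * (real k - 1) - 4 + 1 / 2 * ?E" .
qed

end
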